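(* There are oblivious message adversaries for which solving consensus takes $\Omega(n\,1.3^n)$ rounds. Precisely: there exist constants $\kappa>0$ and $n_0$ such that for every $n\ge n_0$ there is a set $\mathbf{D}$ of rooted communication graphs on $n$ processes such that consensus is solvable under $\mathbf{D}$, and for every consensus algorithm correct under $\mathbf{D}$ there is a run in which some process has not decided by the end of round $\lfloor\kappa\, n\, 1.3^n\rfloor$.
   Context: **Model.** $\Pi=\{p_1,\dots,p_n\}$ is a set of $n$ processes. A communication graph is a directed graph on $\Pi$ containing all self-loops. It is rooted if it has exactly one root component, i.e. exactly one strongly connected component with no incoming edge from outside. An oblivious message adversary is given by a nonempty set $\mathbf{D}$ of communication graphs; its admissible infinite communication patterns are all sequences $\sigma=(\sigma(1),\sigma(2),\dots)\in\mathbf{D}^\omega$ with every $\sigma(r)\in\mathbf{D}$. Given inputs $(x_p)_{p\in\Pi}$, views are defined by $\mathrm{view}_\sigma(p,0)=\{(p,0,x_p)\}$ and, for $r\ge1$, $\mathrm{view}_\sigma(p,r)=(p,r,\{\mathrm{view}_\sigma(q,r-1):(q,p)\in\sigma(r)\})$. **Consensus.** Each process $p$ has an input $x_p$ from a finite domain $V$ with $|V|\ge2$; all input assignments are possible. A (deterministic, full-information) consensus algorithm is a family of decision functions $\Delta_p$ mapping each possible view of $p$ to $V\cup\{\bot\}$ such that if $\Delta_p(\mathrm{view}_\sigma(p,r))\ne\bot$ then $\Delta_p(\mathrm{view}_\sigma(p,r'))=\Delta_p(\mathrm{view}_\sigma(p,r))$ for all $r'\ge r$. A run is determined by an input assignment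 and some $\sigma\in\mathbf{D}^\omega$; $p$ has decided $v\neq\bot$ by (the end of) round $r$ if $\Delta_p(\mathrm{view}_\sigma(p,r))=v$. The algorithm is correct under $\mathbf{D}$ if in every run every process eventually decides (termination), no two processes decide differently (agreement), and every decided value is the input of some process (validity). Consensus is solvable under $\mathbf{D}$ if a correct algorithm exists. *)

theory Defs
  imports Complex_Main "HOL-Library.FSet" "HOL-Library.FuncSet" "Graph_Theory.Graph_Theory"
begin

definition procs :: "nat \<Rightarrow> nat set" where
  "procs n = {1..n}"

definition comm_graph :: "nat \<Rightarrow> nat pair_pre_digraph \<Rightarrow> bool" where
  "comm_graph n G \<longleftrightarrow>
     pair_wf_digraph G \<and> pverts G = procs n \<and> (\<forall>p\<in>procs n. (p, p) \<in> parcs G)"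

definition root_component :: "'a pair_pre_digraph \<Rightarrow> 'a set \<Rightarrow> bool" where
  "root_component G C \<longleftrightarrow>
     C \<in> pre_digraph.sccs_verts (with_proj G) \<and>
     (\<forall>(u, v)\<in>parcs G. v \<in> C \<longrightarrow> u \<in> C)"

definition rooted :: "'a pair_pre_digraph \<Rightarrow> bool" where
  "rooted G \<longleftrightarrow> (\<exists>!C. root_component G C)"

definition oblivious_adversary :: "nat \<Rightarrow> nat pair_pre_digraph set \<Rightarrow> bool" where
  "oblivious_adversary n D \<longleftrightarrow> D \<noteq> {} \<and> (\<forall>G\<in>D. comm_graph n G)"

text \<open>Rounds are numbered from 1, so the value of a communication pattern at 0 is irrelevant.\<close>

definition admissible :: "'g set \<Rightarrow> (nat \<Rightarrow> 'g) \<Rightarrow> bool" where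
  "admissible D \<sigma> \<longleftrightarrow> (\<forall>r\<ge>1. \<sigma> r \<in> D)"

text \<open>
  \<open>InitView p a\<close> stands for the round-0 view \<open>{(p, 0, a)}\<close>; \<open>RoundView p r A\<close> stands
  for the triple \<open>(p, r, A)\<close>.  Finite sets are used because a datatype cannot recurse
  through unrestricted sets.
\<close>

datatype 'v view = InitView nat 'v | RoundView nat nat "'v view fset"

text \<open>
  The function \<open>Abs_fset\<close> is meaningful on finite sets only; the set of in-neighbours of a
  process is finite in every communication graph.
\<close>

primrec view_at :: "(nat \<Rightarrow> nat pair_pre_digraph) \<Rightarrow> (nat \<Rightarrow> 'v) \<Rightarrow> nat \<Rightarrow> nat \<Rightarrow> 'v view" where
  "view_at \<sigma> x 0 = (\<lambda>p. InitView p (x p))"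
| "view_at \<sigma> x (Suc r) = (\<lambda>p. RoundView p (Suc r)
     (view_at \<sigma> x r |`| Abs_fset {q. (q, p) \<in> parcs (\<sigma> (Suc r))}))"

text \<open>
  A run is given by a communication pattern and an input assignment, of which only the values
  on the processes matter.
\<close>

definition run ::
  "nat \<Rightarrow> 'v set \<Rightarrow> nat pair_pre_digraph set \<Rightarrow>
   (nat \<Rightarrow> nat pair_pre_digraph) \<Rightarrow> (nat \<Rightarrow> 'v) \<Rightarrow> bool" where
  "run n V D \<sigma> x \<longleftrightarrow> admissible D \<sigma> \<and> x \<in> procs n \<rightarrow> V"

text \<open>
  The value \<open>None\<close> plays the role of \<open>\<bottom>\<close>.  Decision functions are total here, but
  only their values on views that occur in some run are constrained or used.
\<close>

type_synonym 'v decision = "nat \<Rightarrow> 'v view \<Rightarrow> 'v option"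

definition consensus_algorithm ::
  "nat \<Rightarrow> 'v set \<Rightarrow> nat pair_pre_digraph set \<Rightarrow> 'v decision \<Rightarrow> bool" where
  "consensus_algorithm n V D \<Delta> \<longleftrightarrow>
     (\<forall>\<sigma> x. run n V D \<sigma> x \<longrightarrow> (\<forall>p\<in>procs n. \<forall>r.
        \<Delta> p (view_at \<sigma> x r p) \<in> insert None (Some ` V) \<and>
        (\<Delta> p (view_at \<sigma> x r p) \<noteq> None \<longrightarrow>
           (\<forall>r'\<ge>r. \<Delta> p (view_at \<sigma> x r' p) = \<Delta> p (view_at \<sigma> x r p)))))"

definition decided_by ::
  "'v decision \<Rightarrow> (nat \<Rightarrow> nat pair_pre_digraph) \<Rightarrow> (nat \<Rightarrow> 'v) \<Rightarrow> nat \<Rightarrow> nat \<Rightarrow> 'v \<Rightarrow> bool" where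
  "decided_by \<Delta> \<sigma> x p r v \<longleftrightarrow> \<Delta> p (view_at \<sigma> x r p) = Some v"

definition termination_prop ::
  "nat \<Rightarrow> 'v decision \<Rightarrow> (nat \<Rightarrow> nat pair_pre_digraph) \<Rightarrow> (nat \<Rightarrow> 'v) \<Rightarrow> bool" where
  "termination_prop n \<Delta> \<sigma> x \<longleftrightarrow> (\<forall>p\<in>procs n. \<exists>r v. decided_by \<Delta> \<sigma> x p r v)"

definition agreement_prop ::
  "nat \<Rightarrow> 'v decision \<Rightarrow> (nat \<Rightarrow> nat pair_pre_digraph) \<Rightarrow> (nat \<Rightarrow> 'v) \<Rightarrow> bool" where
  "agreement_prop n \<Delta> \<sigma> x \<longleftrightarrow>
     (\<forall>p\<in>procs n. \<forall>q\<in>procs n. \<forall>r s v w.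
        decided_by \<Delta> \<sigma> x p r v \<and> decided_by \<Delta> \<sigma> x q s w \<longrightarrow> v = w)"

definition validity_prop ::
  "nat \<Rightarrow> 'v decision \<Rightarrow> (nat \<Rightarrow> nat pair_pre_digraph) \<Rightarrow> (nat \<Rightarrow> 'v) \<Rightarrow> bool" where
  "validity_prop n \<Delta> \<sigma> x \<longleftrightarrow>
     (\<forall>p\<in>procs n. \<forall>r v. decided_by \<Delta> \<sigma> x p r v \<longrightarrow> v \<in> x ` procs n)"

definition correct_consensus ::
  "nat \<Rightarrow> 'v set \<Rightarrow> nat pair_pre_digraph set \<Rightarrow> 'v decision \<Rightarrow> bool" where
  "correct_consensus n V D \<Delta> \<longleftrightarrow>
     consensus_algorithm n V D \<Delta> \<and>
     (\<forall>\<sigma> x. run n V D \<sigma> x \<longrightarrow>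
        termination_prop n \<Delta> \<sigma> x \<and> agreement_prop n \<Delta> \<sigma> x \<and> validity_prop n \<Delta> \<sigma> x)"

definition consensus_solvable ::
  "nat \<Rightarrow> 'v set \<Rightarrow> nat pair_pre_digraph set \<Rightarrow> bool" where
  "consensus_solvable n V D \<longleftrightarrow> (\<exists>\<Delta>. correct_consensus n V D \<Delta>)"

end

theory Submission
  imports Defs "HOL-Real_Asymp.Real_Asymp"
begin

text \<open>
  Fix distinct sets \<open>R 0, \<dots>, R (m - 1)\<close> of \<open>k\<close> processes each, consecutive ones disjoint.
  The adversary consists of the complete graph and, for every \<open>t\<close>, of a leaf graph \<open>t\<close> in which
  processes in \<open>R (t - 1)\<close> (none if \<open>t = 0\<close>) hear everybody and all others hear only \<open>R t\<close> and themselves.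
  Replacing leaf \<open>t\<close> by the complete graph in the first round goes unnoticed exactly by \<open>R (t - 1)\<close>,
  so it stays hidden only if nobody outside \<open>R (t - 1)\<close> is heard later on, which forces the
  second graph to be leaf \<open>t - 1\<close>.  Call two patterns linked at time \<open>T\<close> if a chain of patterns,
  neighbours looking alike to some process, joins them.  By induction on \<open>T\<close>, if linked patterns
  start with distinct leaves \<open>t\<close> and \<open>s\<close>, then \<open>t, s \<ge> T - 1\<close>; after \<open>m + 1\<close> rounds every class
  therefore has a common broadcaster, whose input can be decided.  Conversely, patterns that use in
  round \<open>r\<close> only leaves \<open>t > T - r\<close> are all linked, so at time \<open>m - 2\<close> repeating leaf \<open>m - 1\<close> and
  repeating leaf \<open>m - 2\<close> are still linked although their root components are disjoint.  Taking
  subsets of size \<open>h div 2\<close> alternately from two disjoint sets of \<open>h = n div 2\<close> processes gives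
  \<open>m = 2 * (h choose (h div 2))\<close>, which grows like \<open>sqrt 2 ^ n\<close> up to a polynomial factor.
\<close>

section \<open>Views and causal pasts\<close>

definition in_nbrs :: "nat pair_pre_digraph \<Rightarrow> nat \<Rightarrow> nat set" where
  "in_nbrs G p = {q. (q, p) \<in> parcs G}"

lemma comm_graph_in_nbrs:
  assumes "comm_graph n G" "p \<in> procs n"
  shows "in_nbrs G p \<subseteq> procs n" "p \<in> in_nbrs G p" "finite (in_nbrs G p)"
proof -
  interpret pair_wf_digraph G using assms by (simp add: comm_graph_def)
  show sub: "in_nbrs G p \<subseteq> procs n"
    using assms arc_fst_in_verts by (force simp: in_nbrs_def comm_graph_def)
  show "p \<in> in_nbrs G p"
    using assms by (simp add: in_nbrs_def comm_graph_def)
  show "finite (in_nbrs G p)"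
    using finite_subset[OF sub] by (simp add: procs_def)
qed

primrec heard :: "(nat \<Rightarrow> nat pair_pre_digraph) \<Rightarrow> nat \<Rightarrow> nat \<Rightarrow> nat set" where
  "heard \<sigma> 0 = (\<lambda>p. {p})"
| "heard \<sigma> (Suc r) = (\<lambda>p. \<Union>q\<in>in_nbrs (\<sigma> (Suc r)) p. heard \<sigma> r q)"

text \<open>The input-free half of view equality; inputs enter through \<open>heard\<close> in
  \<open>view_at_eq_iff\<close>.\<close>

primrec same_past ::
  "(nat \<Rightarrow> nat pair_pre_digraph) \<Rightarrow> (nat \<Rightarrow> nat pair_pre_digraph) \<Rightarrow> nat \<Rightarrow> nat \<Rightarrow> bool" where
  "same_past \<sigma> \<sigma>' 0 = (\<lambda>p. True)"
| "same_past \<sigma> \<sigma>' (Suc r) = (\<lambda>p. in_nbrs (\<sigma> (Suc r)) p = in_nbrs (\<sigma>' (Suc r)) p \<and>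
     (\<forall>q\<in>in_nbrs (\<sigma> (Suc r)) p. same_past \<sigma> \<sigma>' r q))"

lemma same_past_sym: "same_past \<sigma> \<sigma>' r p \<Longrightarrow> same_past \<sigma>' \<sigma> r p"
  by (induction r arbitrary: p) auto

lemma same_past_refl: "same_past \<sigma> \<sigma> r p"
  by (induction r arbitrary: p) auto

lemma same_past_cong:
  assumes "\<And>r. r \<ge> 1 \<Longrightarrow> \<sigma> r = \<sigma>' r"
  shows "same_past \<sigma> \<sigma>' r p"
  by (induction r arbitrary: p) (use assms in auto)

fun view_proc :: "'v view \<Rightarrow> nat" where
  "view_proc (InitView p a) = p"
| "view_proc (RoundView p r A) = p"

lemma view_proc_view_at [simp]: "view_proc (view_at \<sigma> x r p) = p"
  by (cases r) auto

lemma view_at_same_round: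
  assumes "view_at \<sigma> x r p = view_at \<sigma>' x' r' p'"
  shows "r = r'"
  using assms by (cases r; cases r') auto

text \<open>A view names its owner, so \<open>view_proc\<close> recovers each index from its
  image.\<close>

lemma image_view_eq_iff:
  assumes f: "\<And>q. view_proc (f q) = q" and g: "\<And>q. view_proc (g q) = q"
  shows "f ` A = g ` B \<longleftrightarrow> A = B \<and> (\<forall>q\<in>A. f q = g q)"
proof
  assume eq: "f ` A = g ` B"
  have inv: "f q = g q" if "f q = g q'" for q q'
  proof -
    have "view_proc (f q) = view_proc (g q')" using that by (rule arg_cong)
    then have "q = q'" unfolding f g .
    then show ?thesis using that by (simp only:)
  qed
  have "view_proc ` f ` A = view_proc ` g ` B" unfolding eq ..
  then have "A = B" unfolding image_image f g by (simp only: image_ident)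
  moreover have "f q = g q" if "q \<in> A" for q
  proof -
    have "f q \<in> g ` B" using imageI[OF that, of f] unfolding eq .
    then obtain q' where "f q = g q'" by (rule imageE)
    then show ?thesis by (rule inv)
  qed
  ultimately show "A = B \<and> (\<forall>q\<in>A. f q = g q)" by blast
next
  assume "A = B \<and> (\<forall>q\<in>A. f q = g q)"
  then show "f ` A = g ` B" by (intro image_cong) blast+
qed

lemma admissible_comm_graph:
  assumes "oblivious_adversary n D" "admissible D \<sigma>"
  shows "comm_graph n (\<sigma> (Suc r))"
  using assms by (simp add: oblivious_adversary_def admissible_def)

lemma admissible_in_nbrs:
  assumes "oblivious_adversary n D" "admissible D \<sigma>" "p \<in> procs n"
  shows "in_nbrs (\<sigma> (Suc r)) p \<subseteq> procs n" "p \<in> in_nbrs (\<sigma> (Suc r)) p"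
    "finite (in_nbrs (\<sigma> (Suc r)) p)"
  using comm_graph_in_nbrs[OF admissible_comm_graph[OF assms(1,2)] assms(3)] by auto

lemma view_at_eq_iff:
  assumes "oblivious_adversary n D" "admissible D \<sigma>" "admissible D \<sigma>'" "p \<in> procs n"
  shows "view_at \<sigma> x r p = view_at \<sigma>' x' r p \<longleftrightarrow>
    same_past \<sigma> \<sigma>' r p \<and> (\<forall>q\<in>heard \<sigma> r p. x q = x' q)"
  using assms(4)
proof (induction r arbitrary: p)
  case (Suc r)
  let ?A = "in_nbrs (\<sigma> (Suc r)) p" and ?B = "in_nbrs (\<sigma>' (Suc r)) p"
  note A = admissible_in_nbrs[OF assms(1,2) Suc.prems, of r]
  note B = admissible_in_nbrs[OF assms(1,3) Suc.prems, of r]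
  have "view_at \<sigma> x (Suc r) p = view_at \<sigma>' x' (Suc r) p \<longleftrightarrow>
      view_at \<sigma> x r |`| Abs_fset ?A = view_at \<sigma>' x' r |`| Abs_fset ?B"
    by (simp add: in_nbrs_def)
  \<comment> \<open>In-neighbourhoods are finite, so \<open>Abs_fset\<close> is faithful on
    them.\<close>
  also have "\<dots> \<longleftrightarrow> view_at \<sigma> x r ` ?A = view_at \<sigma>' x' r ` ?B"
    using A(3) B(3) by (simp add: fset_inject[symmetric] Abs_fset_inverse)
  also have "\<dots> \<longleftrightarrow> ?A = ?B \<and> (\<forall>q\<in>?A. view_at \<sigma> x r q = view_at \<sigma>' x' r q)"
    by (rule image_view_eq_iff) auto
  also have "\<dots> \<longleftrightarrow> ?A = ?B \<and>
      (\<forall>q\<in>?A. same_past \<sigma> \<sigma>' r q \<and> (\<forall>q'\<in>heard \<sigma> r q. x q' = x' q'))"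
    using Suc.IH A(1) by blast
  finally show ?case by auto
qed auto

lemma same_past_antimono:
  assumes "oblivious_adversary n D" "admissible D \<sigma>" "p \<in> procs n"
    and "same_past \<sigma> \<sigma>' r p" "s \<le> r"
  shows "same_past \<sigma> \<sigma>' s p"
  using assms(5,4)
proof (induction r rule: dec_induct)
  case (step r)
  then show ?case using admissible_in_nbrs(2)[OF assms(1-3)] by auto
qed

lemma heard_mono:
  assumes "oblivious_adversary n D" "admissible D \<sigma>" "p \<in> procs n" "s \<le> r"
  shows "heard \<sigma> s p \<subseteq> heard \<sigma> r p"
  using assms(4)
proof (induction r rule: dec_induct)
  case (step r)
  then show ?case using admissible_in_nbrs(2)[OF assms(1-3)] by auto
qed simp

lemma heard_const:
  assumes "\<And>q. q \<in> R \<Longrightarrow> in_nbrs G q \<subseteq> R" "p \<in> R"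
  shows "heard (\<lambda>_. G) r p \<subseteq> R"
  using assms(2)
proof (induction r arbitrary: p)
  case (Suc r)
  then have "\<forall>q\<in>in_nbrs G p. heard (\<lambda>_. G) r q \<subseteq> R"
    using assms(1) by blast
  then show ?case by auto
qed simp

section \<open>Chains of indistinguishable patterns\<close>

abbreviation (input) shift :: "(nat \<Rightarrow> 'g) \<Rightarrow> nat \<Rightarrow> 'g" where
  "shift \<sigma> \<equiv> (\<lambda>r. \<sigma> (Suc r))"

lemma admissible_shift: "admissible D \<sigma> \<Longrightarrow> admissible D (shift \<sigma>)"
  by (simp add: admissible_def)

text \<open>The recursion of \<open>same_past\<close> peels off the last round. Arguments about the
  first graph need this form, in which only the processes heard from later on have to overlook a
  change in round 1.\<close>

lemma same_past_Suc_shift: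
  "same_past \<sigma> \<sigma>' (Suc r) p \<longleftrightarrow> same_past (shift \<sigma>) (shift \<sigma>') r p \<and>
    (\<forall>q\<in>heard (shift \<sigma>) r p. in_nbrs (\<sigma> (Suc 0)) q = in_nbrs (\<sigma>' (Suc 0)) q)"
proof (induction r arbitrary: p)
  case (Suc r)
  have unfold: "same_past \<sigma> \<sigma>' (Suc (Suc r)) p \<longleftrightarrow>
      in_nbrs (\<sigma> (Suc (Suc r))) p = in_nbrs (\<sigma>' (Suc (Suc r))) p \<and>
      (\<forall>q\<in>in_nbrs (\<sigma> (Suc (Suc r))) p. same_past \<sigma> \<sigma>' (Suc r) q)"
    by (rule same_past.simps(2)[THEN fun_cong])
  have unfold_shift: "same_past (shift \<sigma>) (shift \<sigma>') (Suc r) p \<longleftrightarrow>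
      in_nbrs (\<sigma> (Suc (Suc r))) p = in_nbrs (\<sigma>' (Suc (Suc r))) p \<and>
      (\<forall>q\<in>in_nbrs (\<sigma> (Suc (Suc r))) p. same_past (shift \<sigma>) (shift \<sigma>') r q)"
    by (rule same_past.simps(2)[THEN fun_cong])
  have heard_unfold: "heard (shift \<sigma>) (Suc r) p =
      (\<Union>q\<in>in_nbrs (\<sigma> (Suc (Suc r))) p. heard (shift \<sigma>) r q)"
    by (rule heard.simps(2)[THEN fun_cong])
  show ?case
    unfolding unfold unfold_shift heard_unfold Suc.IH by blast
qed simp

text \<open>Inputs are left out: the lower bound follows a chain under one fixed assignment, and the
  algorithm reads only an input that its process has heard.\<close>

definition indist ::
  "nat \<Rightarrow> nat pair_pre_digraph set \<Rightarrow> nat \<Rightarrow>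
   (nat \<Rightarrow> nat pair_pre_digraph) \<Rightarrow> (nat \<Rightarrow> nat pair_pre_digraph) \<Rightarrow> bool" where
  "indist n D T \<sigma> \<sigma>' \<longleftrightarrow>
     admissible D \<sigma> \<and> admissible D \<sigma>' \<and> (\<exists>p\<in>procs n. same_past \<sigma> \<sigma>' T p)"

text \<open>
  An explicit closure instead of \<open>(indist n D T)\<^sup>*\<^sup>*\<close>: patterns are functions, and with a schematic
  relation higher-order unification becomes ambiguous.
\<close>

inductive linked for n D T \<sigma> where
  linked_refl: "linked n D T \<sigma> \<sigma>"
| linked_step: "linked n D T \<sigma> \<rho> \<Longrightarrow> indist n D T \<rho> \<rho>' \<Longrightarrow> linked n D T \<sigma> \<rho>'"

lemma linked_single: "indist n D T \<sigma> \<sigma>' \<Longrightarrow> linked n D T \<sigma> \<sigma>'"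
  by (rule linked_step[OF linked_refl])

lemma linked_trans:
  assumes "linked n D T \<rho> \<rho>'" "linked n D T \<sigma> \<rho>"
  shows "linked n D T \<sigma> \<rho>'"
  using assms by (induction rule: linked.induct) (blast intro: linked_step)+

lemma indist_sym: "indist n D T \<sigma> \<sigma>' \<Longrightarrow> indist n D T \<sigma>' \<sigma>"
  unfolding indist_def using same_past_sym by blast

lemma linked_sym:
  assumes "linked n D T \<sigma> \<sigma>'"
  shows "linked n D T \<sigma>' \<sigma>"
  using assms
proof (induction rule: linked.induct)
  case (linked_step \<rho> \<rho>')
  show ?case
    by (rule linked_trans[OF linked_step.IH linked_single[OF indist_sym[OF linked_step.hyps(2)]]])
qed (rule linked_refl)

lemma linked_admissible: "linked n D T \<sigma> \<sigma>' \<Longrightarrow> admissible D \<sigma> \<Longrightarrow> admissible D \<sigma>'"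
  by (induction rule: linked.induct) (simp_all add: indist_def)

lemma linked_shift: "linked n D (Suc T) \<sigma> \<sigma>' \<Longrightarrow> linked n D T (shift \<sigma>) (shift \<sigma>')"
proof (induction rule: linked.induct)
  case (linked_step \<rho> \<rho>')
  have "indist n D T (shift \<rho>) (shift \<rho>')"
    using linked_step.hyps(2) admissible_shift[of D \<rho>] admissible_shift[of D \<rho>']
    unfolding indist_def same_past_Suc_shift by blast
  with linked_step.IH show ?case by (rule linked.linked_step)
qed (rule linked_refl)

definition cons_pattern :: "'g \<Rightarrow> (nat \<Rightarrow> 'g) \<Rightarrow> nat \<Rightarrow> 'g" where
  "cons_pattern G \<sigma> = (\<lambda>r. if r \<le> 1 then G else \<sigma> (r - 1))"

lemma cons_pattern_simps [simp]:
  "cons_pattern G \<sigma> (Suc 0) = G" "cons_pattern G \<sigma> (Suc (Suc r)) = \<sigma> (Suc r)"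
  by (auto simp: cons_pattern_def)

lemma admissible_cons_pattern:
  "G \<in> D \<Longrightarrow> admissible D \<sigma> \<Longrightarrow> admissible D (cons_pattern G \<sigma>)"
  by (auto simp: admissible_def cons_pattern_def)

lemma heard_cong:
  assumes "\<And>r. r \<ge> 1 \<Longrightarrow> \<sigma> r = \<sigma>' r"
  shows "heard \<sigma> r p = heard \<sigma>' r p"
  by (induction r arbitrary: p) (use assms in auto)

text \<open>\<open>shift (cons_pattern G \<sigma>)\<close> has \<open>G\<close> at 0, so it need not
  equal \<open>\<sigma>\<close>; the two agree from round 1 on, which is all that is read.\<close>

lemma heard_shift_cons: "heard (shift (cons_pattern G \<sigma>)) r p = heard \<sigma> r p"
  by (rule heard_cong) (simp add: cons_pattern_def)

lemma same_past_cong_both: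
  assumes "\<And>r. r \<ge> 1 \<Longrightarrow> \<sigma> r = \<rho> r" "\<And>r. r \<ge> 1 \<Longrightarrow> \<sigma>' r = \<rho>' r"
  shows "same_past \<sigma> \<sigma>' r p = same_past \<rho> \<rho>' r p"
  by (induction r arbitrary: p) (use assms in auto)

lemma same_past_cons:
  "same_past (cons_pattern G \<sigma>) (cons_pattern G' \<sigma>') (Suc r) p \<longleftrightarrow>
    same_past \<sigma> \<sigma>' r p \<and> (\<forall>q\<in>heard \<sigma> r p. in_nbrs G q = in_nbrs G' q)"
proof -
  have "same_past (shift (cons_pattern G \<sigma>)) (shift (cons_pattern G' \<sigma>')) r p =
      same_past \<sigma> \<sigma>' r p"
    by (rule same_past_cong_both) (simp_all add: cons_pattern_def)
  then show ?thesis
    by (simp only: same_past_Suc_shift heard_shift_cons cons_pattern_simps)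
qed

text \<open>Equal first graphs satisfy the first-round condition of \<open>same_past_cons\<close>
  for every process heard.\<close>

lemma linked_cons:
  assumes "linked n D T \<sigma> \<sigma>'" "G \<in> D"
  shows "linked n D (Suc T) (cons_pattern G \<sigma>) (cons_pattern G \<sigma>')"
  using assms(1)
proof (induction rule: linked.induct)
  case (linked_step \<rho> \<rho>')
  have "indist n D (Suc T) (cons_pattern G \<rho>) (cons_pattern G \<rho>')"
    using linked_step.hyps(2) admissible_cons_pattern[OF assms(2), of \<rho>]
      admissible_cons_pattern[OF assms(2), of \<rho>']
    unfolding indist_def same_past_cons by blast
  with linked_step.IH show ?case by (rule linked.linked_step)
qed (rule linked_refl)

section \<open>Criteria for solvability and for late decisions\<close>

text \<open>A view from time \<open>T\<close> on determines the class of linked patterns, hence one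
  broadcaster chosen for the class, whose input the view contains.\<close>

lemma consensus_solvable_if_common_broadcaster:
  assumes D: "oblivious_adversary n D"
    and common: "\<And>\<sigma>. admissible D \<sigma> \<Longrightarrow>
      \<exists>q\<in>procs n. \<forall>\<sigma>'. linked n D T \<sigma> \<sigma>' \<longrightarrow> (\<forall>p\<in>procs n. q \<in> heard \<sigma>' T p)"
  shows "consensus_solvable n V D"
proof -
  define Q where "Q \<sigma> q \<longleftrightarrow> q \<in> procs n \<and>
    (\<forall>\<sigma>'. linked n D T \<sigma> \<sigma>' \<longrightarrow> (\<forall>p\<in>procs n. q \<in> heard \<sigma>' T p))" for \<sigma> q
  \<comment> \<open>\<open>Q \<sigma>\<close> is the same predicate throughout a class, so the
    choice is constant on it.\<close>
  define c where "c \<sigma> = (SOME q. Q \<sigma> q)" for \<sigma>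
  have c: "Q \<sigma> (c \<sigma>)" if "admissible D \<sigma>" for \<sigma>
  proof -
    have "\<exists>q. Q \<sigma> q" using common[OF that] unfolding Bex_def Q_def .
    then show ?thesis unfolding c_def by (rule someI_ex[of "Q \<sigma>"])
  qed
  have c_eq: "c \<sigma> = c \<sigma>'" if "linked n D T \<sigma> \<sigma>'" for \<sigma> \<sigma>'
  proof -
    have "linked n D T \<sigma> \<rho> \<longleftrightarrow> linked n D T \<sigma>' \<rho>" for \<rho>
      using linked_trans linked_sym that by blast
    then have "Q \<sigma> = Q \<sigma>'" by (intro ext) (simp only: Q_def)
    then show ?thesis by (simp only: c_def)
  qed
  \<comment> \<open>A decision is read off from any run that yields the view at some round from
    \<open>T\<close> on; \<open>\<Delta>_late\<close> shows that the choice of that run does not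
    matter.\<close>
  define occurs where "occurs p v = (\<lambda>(\<sigma>, x :: nat \<Rightarrow> 'a, r). run n V D \<sigma> x \<and> r \<ge> T \<and> view_at \<sigma> x r p = v)"
    for p v
  define \<Delta> :: "'a decision" where "\<Delta> p v = (if \<exists>w. occurs p v w
      then (case SOME w. occurs p v w of (\<sigma>, x, r) \<Rightarrow> Some (x (c \<sigma>))) else None)" for p v
  have \<Delta>_late: "\<Delta> p (view_at \<sigma> x r p) = Some (x (c \<sigma>))"
    if run: "run n V D \<sigma> x" and p: "p \<in> procs n" and r: "r \<ge> T" for p \<sigma> x r
  proof -
    let ?v = "view_at \<sigma> x r p"
    have "occurs p ?v (\<sigma>, x, r)" using that by (simp add: occurs_def)
    then have ex: "\<exists>w. occurs p ?v w" by blast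
    obtain \<sigma>' x' r' where w: "(SOME w. occurs p ?v w) = (\<sigma>', x', r')"
      by (metis prod_cases3)
    have "occurs p ?v (\<sigma>', x', r')" using someI_ex[OF ex] w by simp
    then have run': "run n V D \<sigma>' x'" and v: "view_at \<sigma>' x' r' p = ?v"
      by (auto simp: occurs_def)
    have r': "r' = r" using view_at_same_round[OF v] .
    have adm: "admissible D \<sigma>" "admissible D \<sigma>'" using run run' by (auto simp: run_def)
    have eq: "same_past \<sigma> \<sigma>' r p" "\<forall>q\<in>heard \<sigma> r p. x q = x' q"
      using view_at_eq_iff[OF D adm p, of x r x'] v r' by auto
    have "same_past \<sigma> \<sigma>' T p"
      using same_past_antimono[OF D adm(1) p eq(1) r] .
    then have "linked n D T \<sigma> \<sigma>'" using adm p by (intro linked_single) (auto simp: indist_def)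
    then have "c \<sigma> = c \<sigma>'" by (rule c_eq)
    \<comment> \<open>The broadcaster lies in the heard set, where both input assignments
      agree.\<close>
    moreover have "c \<sigma> \<in> heard \<sigma> r p"
      using c[OF adm(1)] heard_mono[OF D adm(1) p r] p linked_refl unfolding Q_def by blast
    ultimately show ?thesis using ex w eq(2) by (auto simp: \<Delta>_def)
  qed
  have \<Delta>_early: "\<Delta> p (view_at \<sigma> x r p) = None" if "r < T" for p \<sigma> x r
  proof -
    have "\<not> occurs p (view_at \<sigma> x r p) w" for w
      using that by (cases w) (auto simp: occurs_def dest!: view_at_same_round)
    then show ?thesis by (simp add: \<Delta>_def)
  qed
  have c_procs: "c \<sigma> \<in> procs n" if "run n V D \<sigma> x" for \<sigma> x
    using c that by (auto simp: Q_def run_def)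
  have \<Delta>_dec: "r \<ge> T \<and> v = x (c \<sigma>)"
    if "run n V D \<sigma> x" "p \<in> procs n" "decided_by \<Delta> \<sigma> x p r v" for \<sigma> x p r v
    using that \<Delta>_late[of \<sigma> x p r] \<Delta>_early[of r p \<sigma> x] by (cases "r \<ge> T") (auto simp: decided_by_def)
  have in_V: "x (c \<sigma>) \<in> V" if "run n V D \<sigma> x" for \<sigma> x
    using that c_procs[OF that] by (auto simp: run_def)
  have "consensus_algorithm n V D \<Delta>"
    unfolding consensus_algorithm_def
  proof (intro allI impI ballI)
    fix \<sigma> x p r
    assume h: "run n V D \<sigma> x" "p \<in> procs n"
    show "\<Delta> p (view_at \<sigma> x r p) \<in> insert None (Some ` V) \<and>
        (\<Delta> p (view_at \<sigma> x r p) \<noteq> None \<longrightarrow>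
           (\<forall>r'\<ge>r. \<Delta> p (view_at \<sigma> x r' p) = \<Delta> p (view_at \<sigma> x r p)))"
    proof (cases "r \<ge> T")
      case True
      then show ?thesis using \<Delta>_late[OF h] in_V[OF h(1)] by simp
    next
      case False
      then show ?thesis using \<Delta>_early[of r p \<sigma> x] by simp
    qed
  qed
  moreover have "termination_prop n \<Delta> \<sigma> x \<and> agreement_prop n \<Delta> \<sigma> x \<and> validity_prop n \<Delta> \<sigma> x"
    if run: "run n V D \<sigma> x" for \<sigma> x
  proof (intro conjI)
    show "termination_prop n \<Delta> \<sigma> x"
      unfolding termination_prop_def decided_by_def using \<Delta>_late[OF run _ order_refl] by blast
    show "agreement_prop n \<Delta> \<sigma> x"
      unfolding agreement_prop_def using \<Delta>_dec[OF run] by blast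
    show "validity_prop n \<Delta> \<sigma> x"
      unfolding validity_prop_def using \<Delta>_dec[OF run] c_procs[OF run] by blast
  qed
  ultimately show ?thesis
    unfolding consensus_solvable_def correct_consensus_def by blast
qed

text \<open>Fix inputs \<open>a\<close> on what \<open>p\<close> hears in \<open>\<sigma>\<close>
  and \<open>b\<close> elsewhere. If everybody had always decided by round \<open>t\<close>, the
  decision would be \<open>a\<close> at one end of the chain, \<open>b\<close> at the other, and
  constant along it.\<close>

lemma undecided_if_linked_disjoint:
  assumes D: "oblivious_adversary n D" and \<Delta>: "correct_consensus n V D \<Delta>"
    and V: "a \<in> V" "b \<in> V" "a \<noteq> b"
    and link: "linked n D T \<sigma> \<sigma>'" and adm: "admissible D \<sigma>"
    and p: "p \<in> procs n" "p' \<in> procs n"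
    and disj: "heard \<sigma> T p \<inter> heard \<sigma>' T p' = {}"
    and t: "t \<le> T"
  shows "\<exists>\<sigma> x. run n V D \<sigma> x \<and> (\<exists>p\<in>procs n. \<not> (\<exists>v. decided_by \<Delta> \<sigma> x p t v))"
proof (rule ccontr)
  assume "\<not> ?thesis"
  then have dec_t: "\<exists>v. decided_by \<Delta> \<sigma> x p t v" if "run n V D \<sigma> x" "p \<in> procs n" for \<sigma> x p
    using that by blast
  have dec: "\<exists>v. \<Delta> p (view_at \<sigma> x T p) = Some v"
    if h: "run n V D \<sigma> x" "p \<in> procs n" for \<sigma> x p
  proof -
    obtain v where v: "\<Delta> p (view_at \<sigma> x t p) = Some v"
      using dec_t[OF h] by (auto simp: decided_by_def)
    then have "\<Delta> p (view_at \<sigma> x T p) = \<Delta> p (view_at \<sigma> x t p)"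
      using \<Delta> h t unfolding correct_consensus_def consensus_algorithm_def by blast
    then show ?thesis using v by simp
  qed
  have agree: "\<Delta> p (view_at \<sigma> x T p) = \<Delta> q (view_at \<sigma> x T q)"
    if h: "run n V D \<sigma> x" "p \<in> procs n" "q \<in> procs n" for \<sigma> x p q
  proof -
    have "agreement_prop n \<Delta> \<sigma> x" using \<Delta> h by (auto simp: correct_consensus_def)
    then show ?thesis
      using dec[OF h(1,2)] dec[OF h(1,3)] h(2,3)
      unfolding agreement_prop_def decided_by_def by metis
  qed
  \<comment> \<open>Such a process cannot exclude that all inputs are \<open>e\<close>, where
    validity forces \<open>e\<close>.\<close>
  have unanimous: "\<Delta> p (view_at \<rho> x T p) = Some e"
    if h: "run n V D \<rho> x" "p \<in> procs n" "e \<in> V" "\<forall>q\<in>heard \<rho> T p. x q = e" for \<rho> x p e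
  proof -
    have run: "run n V D \<rho> (\<lambda>_. e)" using h by (auto simp: run_def)
    have "view_at \<rho> x T p = view_at \<rho> (\<lambda>_. e) T p"
      using view_at_eq_iff[OF D _ _ h(2), of \<rho> \<rho>] h same_past_refl by (auto simp: run_def)
    moreover have "validity_prop n \<Delta> \<rho> (\<lambda>_. e)"
      using \<Delta> run by (auto simp: correct_consensus_def)
    ultimately show ?thesis
      using dec[OF run h(2)] h(2) unfolding validity_prop_def decided_by_def by fastforce
  qed
  define x where "x q = (if q \<in> heard \<sigma> T p then a else b)" for q
  have run: "run n V D \<rho> x" if "admissible D \<rho>" for \<rho>
    using that V by (auto simp: run_def x_def)
  have "\<forall>q\<in>procs n. \<Delta> q (view_at \<sigma>' x T q) = Some a"
    using link
  proof (induction rule: linked.induct)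
    case linked_refl
    have "\<Delta> p (view_at \<sigma> x T p) = Some a"
      using unanimous[OF run[OF adm] p(1) V(1)] by (simp add: x_def)
    then show ?case using agree[OF run[OF adm] p(1)] by metis
  next
    case (linked_step \<rho> \<rho>')
    \<comment> \<open>The process that cannot tell the patterns apart carries the value over, and
      agreement spreads it to the others.\<close>
    then obtain q where q: "q \<in> procs n" "same_past \<rho> \<rho>' T q"
      and adm': "admissible D \<rho>" "admissible D \<rho>'" by (auto simp: indist_def)
    have "view_at \<rho> x T q = view_at \<rho>' x T q"
      using view_at_eq_iff[OF D adm' q(1)] q(2) by blast
    then have "\<Delta> q (view_at \<rho>' x T q) = Some a" using linked_step.IH q by metis
    then show ?case using agree[OF run[OF adm'(2)] q(1)] by metis
  qed
  moreover have "\<Delta> p' (view_at \<sigma>' x T p') = Some b"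
  proof (rule unanimous[OF run[OF linked_admissible[OF link adm]] p(2) V(2)])
    show "\<forall>q\<in>heard \<sigma>' T p'. x q = b"
      using disj by (auto simp: x_def)
  qed
  ultimately show False using p(2) V(3) by auto
qed

section \<open>Rootedness and the star adversary\<close>

text \<open>\<open>R\<close> has edges to everybody and receives none from outside: it is one
  component, and any nonempty set closed under predecessors must meet it.\<close>

lemma rooted_if_dominating_clique:
  assumes G: "pair_wf_digraph G" and R: "R \<noteq> {}" "R \<subseteq> pverts G"
    and dom: "\<And>u v. u \<in> R \<Longrightarrow> v \<in> pverts G \<Longrightarrow> (u, v) \<in> parcs G"
    and closed: "\<And>u v. (u, v) \<in> parcs G \<Longrightarrow> v \<in> R \<Longrightarrow> u \<in> R"
  shows "rooted G"
proof -
  interpret pair_wf_digraph G by fact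
  have reach: "v \<in> R" if "v \<rightarrow>\<^sup>*\<^bsub>with_proj G\<^esub> u" "u \<in> R" for u v
    using that by (induction rule: converse_reachable_induct) (auto dest: closed)
  have scc: "R \<in> sccs_verts"
    unfolding in_sccs_verts_conv_reachable
  proof (intro conjI ballI allI impI)
    fix u v assume "u \<in> R" "v \<in> R"
    then show "u \<rightarrow>\<^sup>*\<^bsub>with_proj G\<^esub> v"
      using dom R by (intro reachable_adjI) auto
  qed (use R reach in auto)
  have root: "root_component G R"
    using scc closed by (auto simp: root_component_def)
  have "C = R" if C: "root_component G C" for C
  proof -
    have Cs: "C \<in> sccs_verts" and Cc: "\<forall>(u, v)\<in>parcs G. v \<in> C \<longrightarrow> u \<in> C"
      using C by (auto simp: root_component_def)
    obtain v where v: "v \<in> C" using Cs by (auto simp: in_sccs_verts_conv_reachable)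
    have vG: "v \<in> pverts G" using v Cs
      by (metis in_sccs_verts_conv_reachable reachable_in_verts(1) with_proj_simps(1))
    obtain u where u: "u \<in> R" using R by auto
    then have "u \<in> C" using dom[OF u vG] Cc v by auto
    then have "C \<inter> R \<noteq> {}" using u by auto
    then show ?thesis using sccs_verts_disjoint[OF Cs scc] by blast
  qed
  then show ?thesis using root by (auto simp: rooted_def)
qed

text \<open>
  The node \<open>None\<close> stands for the complete graph, \<open>Some t\<close> for the graph whose root
  component is \<open>R t\<close>.
\<close>

locale star_adversary =
  fixes n k m :: nat and R :: "nat \<Rightarrow> nat set"
  assumes R_sub: "t < m \<Longrightarrow> R t \<subseteq> procs n"
    and R_card: "t < m \<Longrightarrow> card (R t) = k"
    and R_inj: "inj_on R {..<m}"
    and R_disj: "Suc t < m \<Longrightarrow> R t \<inter> R (Suc t) = {}"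
    and k_pos: "0 < k" and k_less: "k + 1 < n" and m_ge: "2 \<le> m"
begin

text \<open>Without the guard \<open>0 < t\<close>, truncated subtraction would make
  \<open>R 0\<close> its own predecessor.\<close>

definition nbrs :: "nat option \<Rightarrow> nat \<Rightarrow> nat set" where
  "nbrs i p = (case i of None \<Rightarrow> procs n
     | Some t \<Rightarrow> if 0 < t \<and> p \<in> R (t - 1) then procs n else insert p (R t))"

definition node_root :: "nat option \<Rightarrow> nat set" where
  "node_root i = (case i of None \<Rightarrow> procs n | Some t \<Rightarrow> R t)"

definition graph :: "nat option \<Rightarrow> nat pair_pre_digraph" where
  "graph i = \<lparr>pverts = procs n, parcs = {(q, p). p \<in> procs n \<and> q \<in> nbrs i p}\<rparr>"

definition nodes :: "nat option set" where
  "nodes = insert None (Some ` {..<m})"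

definition D :: "nat pair_pre_digraph set" where
  "D = graph ` nodes"

lemma Some_nodes [simp]: "Some t \<in> nodes \<longleftrightarrow> t < m"
  and None_nodes [simp]: "None \<in> nodes"
  by (auto simp: nodes_def)

lemma graph_in_D [simp]: "i \<in> nodes \<Longrightarrow> graph i \<in> D"
  by (simp add: D_def)

lemma card_procs [simp]: "card (procs n) = n" and finite_procs [simp]: "finite (procs n)"
  by (auto simp: procs_def)

lemma finite_R: "t < m \<Longrightarrow> finite (R t)"
  using R_sub finite_subset finite_procs by blast

lemma R_procs: "x \<in> R t \<Longrightarrow> t < m \<Longrightarrow> x \<in> procs n"
  using R_sub by blast

lemma R_nonempty: "t < m \<Longrightarrow> R t \<noteq> {}"
  using R_card[of t] k_pos by auto

lemma procs_nonempty: "procs n \<noteq> {}"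
  using k_less by (simp add: procs_def)

lemma in_nbrs_graph: "p \<in> procs n \<Longrightarrow> in_nbrs (graph i) p = nbrs i p"
  by (simp add: in_nbrs_def graph_def)

lemma node_root_sub: "i \<in> nodes \<Longrightarrow> node_root i \<subseteq> procs n"
  using R_procs by (auto simp: node_root_def split: option.splits)

lemma node_root_nonempty: "i \<in> nodes \<Longrightarrow> node_root i \<noteq> {}"
  using R_nonempty procs_nonempty by (auto simp: node_root_def split: option.splits)

lemma nbrs_sub: "i \<in> nodes \<Longrightarrow> p \<in> procs n \<Longrightarrow> nbrs i p \<subseteq> procs n"
  using R_procs by (auto simp: nbrs_def split: option.splits if_splits)

lemma self_nbrs: "p \<in> procs n \<Longrightarrow> p \<in> nbrs i p"
  by (auto simp: nbrs_def split: option.splits)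

lemma node_root_nbrs: "i \<in> nodes \<Longrightarrow> node_root i \<subseteq> nbrs i p"
  using R_procs by (auto simp: nbrs_def node_root_def split: option.splits)

lemma nbrs_node_root:
  assumes "i \<in> nodes" "p \<in> node_root i"
  shows "nbrs i p = node_root i"
proof (cases i)
  case (Some t)
  then have "p \<notin> R (t - 1)" if "0 < t"
    using R_disj[of "t - 1"] that assms by (auto simp: node_root_def)
  then show ?thesis
    using Some assms by (auto simp: nbrs_def node_root_def)
qed (simp add: nbrs_def node_root_def)

lemma comm_graph_graph:
  assumes "i \<in> nodes"
  shows "comm_graph n (graph i)"
proof -
  have "pair_wf_digraph (graph i)"
    using nbrs_sub[OF assms] by unfold_locales (auto simp: graph_def, blast)
  then show ?thesis
    using self_nbrs by (auto simp: comm_graph_def graph_def)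
qed

lemma oblivious: "oblivious_adversary n D"
  using comm_graph_graph by (auto simp: oblivious_adversary_def D_def nodes_def)

lemma rooted_graph:
  assumes i: "i \<in> nodes"
  shows "rooted (graph i)"
proof (rule rooted_if_dominating_clique[of _ "node_root i"])
  show "pair_wf_digraph (graph i)"
    using comm_graph_graph[OF i] by (simp add: comm_graph_def)
qed (use node_root_nonempty[OF i] node_root_sub[OF i] node_root_nbrs[OF i] nbrs_node_root[OF i]
  in \<open>auto simp: graph_def\<close>)

text \<open>By \<open>k + 1 < n\<close>: the left side has at most \<open>k + 1\<close>
  elements.\<close>

lemma insert_R_neq_procs: "t < m \<Longrightarrow> insert p (R t) \<noteq> procs n"
  using card_insert_le_m1[of k "R t" p] R_card[of t] finite_R[of t] k_less card_procs
  by (metis Suc_eq_plus1 card_insert_if less_irrefl less_Suc_eq)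

lemma R_eq_iff: "t < m \<Longrightarrow> s < m \<Longrightarrow> R t = R s \<longleftrightarrow> t = s"
  using R_inj by (auto simp: inj_on_def)

text \<open>All \<open>R t\<close> have \<open>k\<close> elements, so the size of the common set
  tells whether \<open>p\<close> lies in both sets or in neither; removing it in the latter case
  leaves equal sets.\<close>

lemma insert_R_inj:
  assumes "t < m" "s < m" "insert p (R t) = insert p (R s)"
  shows "t = s"
proof -
  have "R t = R s"
    using assms R_card finite_R
    by (metis Suc_n_not_n card_insert_disjoint insert_absorb insert_ident)
  then show ?thesis using assms R_eq_iff by blast
qed

lemma nbrs_Some_eq_None:
  "t < m \<Longrightarrow> nbrs (Some t) p = nbrs None p \<longleftrightarrow> 0 < t \<and> p \<in> R (t - 1)"
  using insert_R_neq_procs by (auto simp: nbrs_def)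

text \<open>A process that does not hear everybody reveals the index through its neighbourhood, by
  \<open>insert_R_inj\<close>, so a confused process hears everybody in both graphs.\<close>

lemma nbrs_Some_eq_Some:
  assumes "t < m" "s < m" "t \<noteq> s" "nbrs (Some t) p = nbrs (Some s) p"
  shows "0 < t \<and> p \<in> R (t - 1) \<and> 0 < s \<and> p \<in> R (s - 1)"
  using assms insert_R_neq_procs[OF assms(1), of p] insert_R_neq_procs[OF assms(2), of p]
    insert_R_inj[OF assms(1,2), of p]
  by (auto simp: nbrs_def split: if_splits)

lemma R_subset_R:
  assumes "t < m" "s < m" "R t \<subseteq> R s"
  shows "t = s"
  using assms R_card R_eq_iff finite_R card_subset_eq by metis

lemma node_root_sub_R:
  assumes "l \<in> nodes" "t < m" "node_root l \<subseteq> R t"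
  shows "l = Some t"
proof (cases l)
  case None
  then have "n \<le> k"
    using assms card_mono[OF finite_R[of t], of "procs n"] R_card by (simp add: node_root_def)
  then show ?thesis using k_less by simp
qed (use assms R_subset_R in \<open>auto simp: node_root_def\<close>)

section \<open>What a chain forces, and solvability\<close>

text \<open>Here \<open>l\<close> stands for the second graph and \<open>j\<close> for the graph
  that replaces leaf \<open>t\<close> in the first round. Confused processes lie in
  \<open>R (t - 1)\<close>, and equal sizes leave only \<open>l = Some (t - 1)\<close>. If
  \<open>j\<close> were another leaf \<open>s\<close>, then \<open>l\<close> would be
  \<open>Some (s - 1)\<close> as well.\<close>

lemma confusing_node:
  assumes "t < m" "j \<in> nodes" "l \<in> nodes" "j \<noteq> Some t"
    and same: "\<And>p. p \<in> node_root l \<Longrightarrow> nbrs (Some t) p = nbrs j p"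
  shows "0 < t \<and> l = Some (t - 1)"
proof (cases j)
  case None
  then have "\<forall>p\<in>node_root l. 0 < t \<and> p \<in> R (t - 1)"
    using same nbrs_Some_eq_None[OF assms(1)] by simp
  then have "0 < t" "node_root l \<subseteq> R (t - 1)"
    using node_root_nonempty[OF assms(3)] by blast+
  then show ?thesis
    using node_root_sub_R[OF assms(3), of "t - 1"] assms(1) by simp
next
  case (Some s)
  then have s: "s < m" "t \<noteq> s" using assms by auto
  then have all: "\<forall>p\<in>node_root l. 0 < t \<and> p \<in> R (t - 1) \<and> 0 < s \<and> p \<in> R (s - 1)"
    using same Some nbrs_Some_eq_Some[OF assms(1) s] by blast
  then have "0 < t" "0 < s" using node_root_nonempty[OF assms(3)] by blast+
  moreover have "l = Some (t - 1)" "l = Some (s - 1)"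
    using all node_root_sub_R[OF assms(3), of "t - 1"] node_root_sub_R[OF assms(3), of "s - 1"]
      assms(1) s by (auto simp: subset_iff)
  ultimately show ?thesis using s by auto
qed

lemma admissible_node:
  assumes "admissible D \<sigma>"
  obtains i where "i \<in> nodes" "\<sigma> (Suc r) = graph i"
  using assms by (auto simp: admissible_def D_def)

lemma node_root_heard:
  assumes "admissible D \<sigma>" "p \<in> procs n" "i \<in> nodes" "\<sigma> (Suc 0) = graph i"
  shows "node_root i \<subseteq> heard \<sigma> (Suc r) p"
proof -
  have "node_root i \<subseteq> heard \<sigma> (Suc 0) p"
    using assms node_root_nbrs by (auto simp: in_nbrs_graph)
  also have "\<dots> \<subseteq> heard \<sigma> (Suc r) p"
    by (rule heard_mono[OF oblivious assms(1,2)]) simp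
  finally show ?thesis .
qed

text \<open>Everybody ends up having heard the root of the second graph, so a process overlooks the
  change of the first graph only if that whole root does.\<close>

lemma indist_second_graph:
  assumes "indist n D (Suc (Suc T)) \<sigma> \<sigma>'" "t < m" "\<sigma> (Suc 0) = graph (Some t)"
    and "\<sigma>' (Suc 0) \<noteq> graph (Some t)"
  shows "0 < t \<and> \<sigma> (Suc (Suc 0)) = graph (Some (t - 1))"
proof -
  have adm: "admissible D \<sigma>" "admissible D \<sigma>'" using assms by (auto simp: indist_def)
  obtain p where p: "p \<in> procs n" "same_past \<sigma> \<sigma>' (Suc (Suc T)) p"
    using assms by (auto simp: indist_def)
  obtain j where j: "j \<in> nodes" "\<sigma>' (Suc 0) = graph j" using admissible_node[OF adm(2)] .
  obtain l where l: "l \<in> nodes" "\<sigma> (Suc (Suc 0)) = graph l" using admissible_node[OF adm(1)] .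
  have heard: "node_root l \<subseteq> heard (shift \<sigma>) (Suc T) p"
    using node_root_heard[OF admissible_shift[OF adm(1)] p(1) l(1)] l(2) by simp
  have "nbrs (Some t) q = nbrs j q" if "q \<in> node_root l" for q
  proof -
    have "in_nbrs (\<sigma> (Suc 0)) q = in_nbrs (\<sigma>' (Suc 0)) q"
      using p(2) heard that unfolding same_past_Suc_shift[of _ _ "Suc T"] by blast
    moreover have "q \<in> procs n" using that node_root_sub[OF l(1)] by auto
    ultimately show ?thesis using assms(3) j(2) by (simp add: in_nbrs_graph)
  qed
  then have "0 < t \<and> l = Some (t - 1)"
    using confusing_node[OF assms(2) j(1) l(1)] assms(4) j(2) by blast
  then show ?thesis using l by simp
qed

text \<open>The first link that leaves the patterns starting with leaf \<open>t\<close> provides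
  \<open>\<rho>\<close>.\<close>

lemma linked_second_graph:
  assumes "linked n D (Suc (Suc T)) \<sigma> \<sigma>'" "t < m" "\<sigma> (Suc 0) = graph (Some t)"
    and "\<sigma>' (Suc 0) \<noteq> graph (Some t)"
  shows "0 < t \<and> (\<exists>\<rho>. linked n D (Suc (Suc T)) \<sigma> \<rho> \<and> \<rho> (Suc (Suc 0)) = graph (Some (t - 1)))"
  using assms(1,4)
proof (induction rule: linked.induct)
  case (linked_step \<rho> \<rho>')
  then show ?case
    using indist_second_graph[OF linked_step.hyps(2) assms(2)] by blast
qed (use assms(3) in simp)

text \<open>From either end, the chain passes a pattern whose second graph is the leaf one lower.
  Dropping round 1 links these two, with distinct leaves \<open>t - 1\<close> and
  \<open>s - 1\<close> in front and one round less.\<close>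

lemma linked_distinct_leaves:
  assumes "linked n D (Suc T) \<sigma> \<sigma>'" "t < m" "s < m" "t \<noteq> s"
    and "\<sigma> (Suc 0) = graph (Some t)" "\<sigma>' (Suc 0) = graph (Some s)"
  shows "T \<le> t"
  using assms
proof (induction T arbitrary: \<sigma> \<sigma>' t s)
  case (Suc T)
  \<comment> \<open>\<open>linked_second_graph\<close> compares graphs rather than indices. Equal
    graphs would put all of \<open>R t\<close> into \<open>R (t - 1)\<close>.\<close>
  have neq: "graph (Some t) \<noteq> graph (Some s)"
  proof
    assume eq: "graph (Some t) = graph (Some s)"
    have "nbrs (Some t) p = nbrs (Some s) p" if "p \<in> R t" for p
      using that R_sub[OF Suc.prems(2)] in_nbrs_graph eq by (metis subsetD)
    then have "\<forall>p\<in>R t. 0 < t \<and> p \<in> R (t - 1)"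
      using nbrs_Some_eq_Some[OF Suc.prems(2-4)] by blast
    then have "R t \<subseteq> R (t - 1)" "0 < t"
      using R_nonempty[OF Suc.prems(2)] by blast+
    then show False
      using R_subset_R[of t "t - 1"] Suc.prems(2) by linarith
  qed
  obtain \<rho> where t: "0 < t" and \<rho>: "linked n D (Suc (Suc T)) \<sigma> \<rho>"
      "\<rho> (Suc (Suc 0)) = graph (Some (t - 1))"
    using linked_second_graph[OF Suc.prems(1,2)] Suc.prems(5,6) neq by auto
  obtain \<rho>' where s: "0 < s" and \<rho>': "linked n D (Suc (Suc T)) \<sigma>' \<rho>'"
      "\<rho>' (Suc (Suc 0)) = graph (Some (s - 1))"
    using linked_second_graph[OF linked_sym[OF Suc.prems(1)] Suc.prems(3)] Suc.prems(5,6) neq by auto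
  have "linked n D (Suc (Suc T)) \<rho> \<rho>'"
    using \<rho>(1) \<rho>'(1) Suc.prems(1) linked_sym by (blast intro: linked_trans)
  then have "linked n D (Suc T) (shift \<rho>) (shift \<rho>')"
    by (rule linked_shift)
  then have "T \<le> t - 1"
    using Suc.IH[of "shift \<rho>" "shift \<rho>'" "t - 1" "s - 1"] \<rho>(2) \<rho>'(2) t s Suc.prems(2-4) by simp
  then show ?case using t by simp
qed simp

lemma solvable: "consensus_solvable n V D"
proof (rule consensus_solvable_if_common_broadcaster[OF oblivious])
  fix \<sigma>
  assume adm: "admissible D \<sigma>"
  \<comment> \<open>At time \<open>m + 1\<close>, two distinct leaves in one class would force
    \<open>m \<le> t\<close>.\<close>
  let ?leaf = "\<lambda>t. t < m \<and> (\<exists>\<sigma>'. linked n D (Suc m) \<sigma> \<sigma>' \<and> \<sigma>' (Suc 0) = graph (Some t))"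
  have unique: "t = s" if "?leaf t" "?leaf s" for t s
  proof (rule ccontr)
    assume "t \<noteq> s"
    obtain \<rho> where \<rho>: "linked n D (Suc m) \<sigma> \<rho>" "\<rho> (Suc 0) = graph (Some t)"
      using \<open>?leaf t\<close> by blast
    obtain \<rho>' where \<rho>': "linked n D (Suc m) \<sigma> \<rho>'" "\<rho>' (Suc 0) = graph (Some s)"
      using \<open>?leaf s\<close> by blast
    have "m \<le> t"
      using linked_distinct_leaves[OF linked_trans[OF \<rho>'(1) linked_sym[OF \<rho>(1)]] _ _ \<open>t \<noteq> s\<close> \<rho>(2) \<rho>'(2)]
        that by simp
    then show False using \<open>?leaf t\<close> by simp
  qed
  have "\<exists>t<m. \<forall>s. ?leaf s \<longrightarrow> s = t"
  proof (cases "\<exists>t. ?leaf t")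
    case True
    then obtain t where "?leaf t" ..
    then show ?thesis using unique by blast
  next
    case False
    \<comment> \<open>Every pattern of the class starts with the complete graph, so any index
      serves.\<close>
    then show ?thesis using m_ge by (intro exI[of _ 0]) auto
  qed
  then obtain t where t: "t < m" "\<And>s. ?leaf s \<Longrightarrow> s = t" by blast
  obtain q where q: "q \<in> R t"
    using R_nonempty[OF t(1)] by blast
  have qn: "q \<in> procs n" using q R_sub t(1) by blast
  show "\<exists>q\<in>procs n. \<forall>\<sigma>'. linked n D (Suc m) \<sigma> \<sigma>' \<longrightarrow> (\<forall>p\<in>procs n. q \<in> heard \<sigma>' (Suc m) p)"
  proof (intro bexI[OF _ qn] allI impI ballI)
    fix \<sigma>' p
    assume link: "linked n D (Suc m) \<sigma> \<sigma>'" and p: "p \<in> procs n"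
    have adm': "admissible D \<sigma>'" using linked_admissible[OF link adm] .
    obtain i where i: "i \<in> nodes" "\<sigma>' (Suc 0) = graph i" using admissible_node[OF adm'] .
    have "q \<in> node_root i"
    proof (cases i)
      case (Some s)
      then have "s = t" using t(2)[of s] i link by auto
      then show ?thesis using Some q by (simp add: node_root_def)
    qed (use qn in \<open>simp add: node_root_def\<close>)
    then show "q \<in> heard \<sigma>' (Suc m) p"
      using node_root_heard[OF adm' p i] by blast
  qed
qed

section \<open>The lower bound on the decision time\<close>

text \<open>A leaf is allowed if its index exceeds the number \<open>T - r\<close> of rounds still
  to come; the sum form avoids truncated subtraction. Dropping round 1 and lowering \<open>T\<close>
  by one preserves the condition.\<close>

definition late_pattern :: "nat \<Rightarrow> (nat \<Rightarrow> nat pair_pre_digraph) \<Rightarrow> bool" where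
  "late_pattern T \<sigma> \<longleftrightarrow> admissible D \<sigma> \<and>
     (\<forall>r\<in>{1..T}. \<sigma> r \<in> graph ` insert None (Some ` {t. t < m \<and> T < t + r}))"

lemma late_pattern_shift: "late_pattern (Suc T) \<sigma> \<Longrightarrow> late_pattern T (shift \<sigma>)"
  unfolding late_pattern_def using admissible_shift by fastforce

lemma late_pattern_const:
  assumes "t < m" "T \<le> t"
  shows "late_pattern T (\<lambda>_. graph (Some t))"
  using assms by (auto simp: late_pattern_def admissible_def)

lemma heard_const_graph:
  assumes "t < m" "p \<in> R t"
  shows "heard (\<lambda>_. graph (Some t)) r p \<subseteq> R t"
proof (rule heard_const)
  fix q assume "q \<in> R t"
  then show "in_nbrs (graph (Some t)) q \<subseteq> R t"
    using nbrs_node_root[of "Some t" q] assms R_sub[OF assms(1)]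
    by (auto simp: node_root_def in_nbrs_graph subset_iff)
qed fact

text \<open>Under the repeated leaf \<open>t - 1\<close>, members of \<open>R (t - 1)\<close> hear
  only each other, and in round 1 all of them hear everybody under either graph.\<close>

lemma linked_leaf_hub:
  assumes "0 < t" "t < m"
  shows "linked n D (Suc T) (cons_pattern (graph (Some t)) (\<lambda>_. graph (Some (t - 1))))
    (cons_pattern (graph None) (\<lambda>_. graph (Some (t - 1))))"
proof -
  let ?\<tau> = "\<lambda>_ :: nat. graph (Some (t - 1))"
  obtain p where p: "p \<in> R (t - 1)"
    using R_nonempty[of "t - 1"] assms(2) by fastforce
  have "in_nbrs (graph (Some t)) q = in_nbrs (graph None) q" if "q \<in> heard ?\<tau> T p" for q
  proof -
    have q: "q \<in> R (t - 1)" using heard_const_graph[OF _ p, of T] that assms(2) by fastforce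
    then have "q \<in> procs n" using R_procs[of q "t - 1"] assms by linarith
    then show ?thesis using nbrs_Some_eq_None[OF assms(2), of q] q assms(1) by (simp add: in_nbrs_graph)
  qed
  then have "same_past (cons_pattern (graph (Some t)) ?\<tau>) (cons_pattern (graph None) ?\<tau>) (Suc T) p"
    unfolding same_past_cons using same_past_refl by blast
  moreover have "admissible D ?\<tau>" "p \<in> procs n"
    using assms p R_procs[of p "t - 1"] by (auto simp: admissible_def)
  ultimately show ?thesis
    using assms by (intro linked_single) (auto simp: indist_def intro!: admissible_cons_pattern)
qed

text \<open>Every late pattern is linked to one that starts with the complete graph and continues
  late; two of these are linked because their tails are, by induction.\<close>

lemma late_patterns_linked:
  assumes "late_pattern T \<sigma>" "late_pattern T \<sigma>'"
  shows "linked n D T \<sigma> \<sigma>'"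
  using assms
proof (induction T arbitrary: \<sigma> \<sigma>')
  case 0
  then show ?case
    using procs_nonempty by (intro linked_single) (auto simp: indist_def late_pattern_def)
next
  case (Suc T)
  have hub: "\<exists>\<tau>. late_pattern T \<tau> \<and> linked n D (Suc T) \<sigma> (cons_pattern (graph None) \<tau>)"
    if late: "late_pattern (Suc T) \<sigma>" for \<sigma>
  proof -
    have adm: "admissible D \<sigma>" using late by (simp add: late_pattern_def)
    have late': "late_pattern T (shift \<sigma>)" using late_pattern_shift[OF late] .
    \<comment> \<open>The two patterns agree from round 1 on but perhaps not at 0, so a link
      replaces equality.\<close>
    have \<sigma>_cons: "linked n D (Suc T) \<sigma> (cons_pattern (\<sigma> (Suc 0)) (shift \<sigma>))"
    proof (intro linked_single, unfold indist_def, intro conjI)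
      obtain p where "p \<in> procs n" using procs_nonempty by blast
      moreover have "same_past \<sigma> (cons_pattern (\<sigma> (Suc 0)) (shift \<sigma>)) (Suc T) p"
        by (rule same_past_cong) (auto simp: cons_pattern_def le_Suc_eq)
      ultimately show "\<exists>p\<in>procs n. same_past \<sigma> (cons_pattern (\<sigma> (Suc 0)) (shift \<sigma>)) (Suc T) p"
        by blast
      show "admissible D (cons_pattern (\<sigma> (Suc 0)) (shift \<sigma>))"
        using adm admissible_shift[OF adm] by (intro admissible_cons_pattern) (auto simp: admissible_def)
    qed fact
    have "\<sigma> (Suc 0) \<in> graph ` insert None (Some ` {t. t < m \<and> Suc T < t + Suc 0})"
      using late unfolding late_pattern_def by force
    then consider "\<sigma> (Suc 0) = graph None"
      | t where "\<sigma> (Suc 0) = graph (Some t)" "t < m" "T < t" by auto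
    then show ?thesis
    proof cases
      case 1
      then show ?thesis using late' \<sigma>_cons unfolding 1 by (intro exI conjI)
    next
      case 2
      \<comment> \<open>First the tail is exchanged for the repeated leaf \<open>t - 1\<close>,
        which is late at \<open>T\<close> because \<open>T < t\<close>; then leaf \<open>t\<close>
        in front can be exchanged for the complete graph.\<close>
      let ?\<tau> = "\<lambda>_ :: nat. graph (Some (t - 1))"
      have "late_pattern T ?\<tau>" using 2 by (intro late_pattern_const) auto
      moreover have "linked n D (Suc T) (cons_pattern (graph (Some t)) (shift \<sigma>))
          (cons_pattern (graph (Some t)) ?\<tau>)"
        by (rule linked_cons[OF Suc.IH[OF late' calculation]]) (simp add: 2(2))
      then have "linked n D (Suc T) \<sigma> (cons_pattern (graph (Some t)) ?\<tau>)"
        using \<sigma>_cons unfolding 2(1) by (rule linked_trans)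
      then have "linked n D (Suc T) \<sigma> (cons_pattern (graph None) ?\<tau>)"
        using 2 by (intro linked_trans[OF linked_leaf_hub]) simp_all
      ultimately show ?thesis by (intro exI conjI)
    qed
  qed
  obtain \<tau> where \<tau>: "late_pattern T \<tau>" "linked n D (Suc T) \<sigma> (cons_pattern (graph None) \<tau>)"
    using hub[OF Suc.prems(1)] by blast
  obtain \<tau>' where \<tau>': "late_pattern T \<tau>'" "linked n D (Suc T) \<sigma>' (cons_pattern (graph None) \<tau>')"
    using hub[OF Suc.prems(2)] by blast
  have "linked n D (Suc T) (cons_pattern (graph None) \<tau>) (cons_pattern (graph None) \<tau>')"
    using Suc.IH[OF \<tau>(1) \<tau>'(1)] by (intro linked_cons) auto
  then show ?case
    using \<tau>(2) linked_sym[OF \<tau>'(2)] by (blast intro: linked_trans)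
qed

text \<open>Time \<open>m - 2\<close> is the last at which two consecutive leaves,
  \<open>m - 2\<close> and \<open>m - 1\<close>, can both be repeated as late patterns. Their roots
  are disjoint and hear only themselves.\<close>

lemma undecided:
  assumes "correct_consensus n V D \<Delta>" "a \<in> V" "b \<in> V" "a \<noteq> b" "t \<le> m - 2"
  shows "\<exists>\<sigma> x. run n V D \<sigma> x \<and> (\<exists>p\<in>procs n. \<not> (\<exists>v. decided_by \<Delta> \<sigma> x p t v))"
proof -
  have idx: "m - 2 < m" "m - 1 < m" "Suc (m - 2) = m - 1" using m_ge by auto
  obtain p where p: "p \<in> R (m - 2)"
    using R_nonempty[OF idx(1)] by blast
  obtain p' where p': "p' \<in> R (m - 1)"
    using R_nonempty[OF idx(2)] by blast
  have "linked n D (m - 2) (\<lambda>_. graph (Some (m - 2))) (\<lambda>_. graph (Some (m - 1)))"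
    using idx by (intro late_patterns_linked late_pattern_const) auto
  moreover have "admissible D (\<lambda>_. graph (Some (m - 2)))"
    using idx by (simp add: admissible_def)
  moreover have "p \<in> procs n" "p' \<in> procs n"
    using p p' R_sub idx by blast+
  moreover have "heard (\<lambda>_. graph (Some (m - 2))) (m - 2) p
      \<inter> heard (\<lambda>_. graph (Some (m - 1))) (m - 2) p' = {}"
    using heard_const_graph[OF idx(1) p, of "m - 2"] heard_const_graph[OF idx(2) p', of "m - 2"]
      R_disj[of "m - 2"] idx by auto
  ultimately show ?thesis
    using undecided_if_linked_disjoint[OF oblivious assms(1-4)] assms(5) by blast
qed

end

section \<open>Size of the family and its growth\<close>

lemma central_binomial_ge: "2 ^ h \<le> (h + 1) * (h choose (h div 2))"
proof -
  have "2 ^ h = (\<Sum>k\<le>h. h choose k)" by (simp add: choose_row_sum)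
  also have "\<dots> \<le> (\<Sum>k\<le>h. h choose (h div 2))" by (intro sum_mono binomial_maximum)
  finally show ?thesis by simp
qed

text \<open>Even indices enumerate the subsets of \<open>{1..h}\<close> of size
  \<open>h div 2\<close>, odd ones their translates by \<open>h\<close>; the alternation makes
  consecutive sets disjoint.\<close>

lemma star_adversary_exists:
  fixes n :: nat
  defines "h \<equiv> n div 2"
  assumes "2 \<le> h"
  shows "\<exists>R. star_adversary n (h div 2) (2 * (h choose (h div 2))) R"
proof -
  let ?k = "h div 2"
  let ?F = "{K. K \<subseteq> {1..h} \<and> card K = ?k}"
  let ?N = "h choose ?k"
  have hn: "2 * h \<le> n" by (simp add: h_def)
  have "card ?F = ?N" using n_subsets[of "{1..h}" ?k] by simp
  moreover have "finite ?F" by simp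
  ultimately obtain f where f: "bij_betw f {..<?N} ?F"
    using ex_bij_betw_nat_finite[of ?F] by (auto simp: atLeast0LessThan)
  have fF: "f i \<subseteq> {1..h}" "card (f i) = ?k" if "i < ?N" for i
    using bij_betwE[OF f] that by auto
  have f_inj: "i = j" if "i < ?N" "j < ?N" "f i = f j" for i j
    using f that by (auto simp: bij_betw_def inj_on_def)
  define R where "R t = (if even t then f (t div 2) else (+) h ` f (t div 2))" for t
  have half: "t div 2 < ?N" if "t < 2 * ?N" for t using that by auto
  have R_low: "R t \<subseteq> {1..h}" if "t < 2 * ?N" "even t" for t
    using fF(1)[OF half[OF that(1)]] that by (simp add: R_def)
  have R_high: "R t \<subseteq> {h + 1..2 * h}" if "t < 2 * ?N" "odd t" for t
    using fF(1)[OF half[OF that(1)]] that by (auto simp: R_def)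
  have card: "card (R t) = ?k" if "t < 2 * ?N" for t
    using fF(2)[OF half[OF that]] by (simp add: R_def card_image)
  have k: "0 < ?k" using assms by simp
  have disj: "R t \<inter> R s = {}" if "t < 2 * ?N" "s < 2 * ?N" "even t \<noteq> even s" for t s
  proof -
    have "{1..h} \<inter> {h + 1..2 * h} = {}" by auto
    then show ?thesis
      using that R_low[OF that(1)] R_low[OF that(2)] R_high[OF that(1)] R_high[OF that(2)] by blast
  qed
  have "star_adversary n ?k (2 * ?N) R"
  proof
    show "R t \<subseteq> procs n" if "t < 2 * ?N" for t
    proof -
      have "{1..h} \<subseteq> procs n" "{h + 1..2 * h} \<subseteq> procs n"
        using hn by (auto simp: procs_def)
      then show ?thesis using R_low[OF that] R_high[OF that] by blast
    qed
    show "inj_on R {..<2 * ?N}"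
    proof (rule inj_onI)
      fix t s
      assume ts: "t \<in> {..<2 * ?N}" "s \<in> {..<2 * ?N}" "R t = R s"
      \<comment> \<open>Equal nonempty sets lie in the same half, so the indices have the same
        parity.\<close>
      have "R t \<noteq> {}" using card[of t] ts(1) k by auto
      then have par: "even t = even s" using disj[of t s] ts by auto
      then have "f (t div 2) = f (s div 2)"
        using ts(3) by (auto simp: R_def inj_image_eq_iff split: if_splits)
      then have "t div 2 = s div 2" using f_inj half ts(1,2) by simp
      then show "t = s" using par by presburger
    qed
    show "R t \<inter> R (Suc t) = {}" if "Suc t < 2 * ?N" for t
      using disj[of t "Suc t"] that by simp
    show "?k + 1 < n" using hn assms by linarith
    show "2 \<le> 2 * ?N" by (simp add: Suc_leI)
  qed (use card k in auto)
  then show ?thesis by blast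
qed

text \<open>Since \<open>1.3 ^ 2 = 1.69 < 2\<close>, the exponential gap absorbs all polynomial
  factors, even with constant 1.\<close>

lemma round_bound:
  "\<exists>n\<^sub>0. \<forall>n\<ge>n\<^sub>0. nat \<lfloor>1 * real n * 1.3 ^ n\<rfloor> \<le> 2 * ((n div 2) choose (n div 2 div 2)) - 2"
proof -
  \<comment> \<open>As \<open>n \<le> 2 * h + 1\<close>, the product bounds
    \<open>n * 1.3 ^ n\<close>; the right side is at most twice the central binomial coefficient,
    and the summand 2 pays for the subtraction in the claim.\<close>
  have "eventually (\<lambda>h. (2 * real h + 1) * (1.3 * 1.69 ^ h) + 2 \<le> 2 * 2 ^ h / (real h + 1)) sequentially"
    by real_asymp
  then obtain h\<^sub>0 where h\<^sub>0:
    "\<And>h. h \<ge> h\<^sub>0 \<Longrightarrow> (2 * real h + 1) * (1.3 * 1.69 ^ h) + 2 \<le> 2 * 2 ^ h / (real h + 1)"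
    by (auto simp: eventually_sequentially)
  have "nat \<lfloor>1 * real n * 1.3 ^ n\<rfloor> \<le> 2 * ((n div 2) choose (n div 2 div 2)) - 2"
    if n: "n \<ge> 2 * h\<^sub>0" for n
  proof -
    define h where "h = n div 2"
    define C where "C = h choose (h div 2)"
    have hn: "n \<le> 2 * h + 1" and hh: "h \<ge> h\<^sub>0" using n by (auto simp: h_def)
    have "(1.3 :: real) ^ n \<le> 1.3 ^ (2 * h + 1)" using hn by (intro power_increasing) auto
    also have "\<dots> = 1.3 * 1.69 ^ h" by (simp add: power_mult power2_eq_square)
    finally have "real n * 1.3 ^ n \<le> (2 * real h + 1) * (1.3 * 1.69 ^ h)"
      using hn by (intro mult_mono) auto
    also have "\<dots> + 2 \<le> 2 * 2 ^ h / (real h + 1)" using h\<^sub>0[OF hh] .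
    also have "\<dots> \<le> 2 * real C"
    proof -
      have "real (2 ^ h) \<le> real ((h + 1) * C)"
        unfolding of_nat_le_iff C_def by (rule central_binomial_ge)
      then show ?thesis by (simp add: field_simps)
    qed
    finally have bound: "real n * 1.3 ^ n \<le> 2 * real C - 2" by simp
    \<comment> \<open>Positivity of \<open>C\<close> keeps the natural subtraction exact.\<close>
    have "0 < C" by (simp add: C_def)
    then have "real (2 * C - 2) = 2 * real C - 2" by (simp add: of_nat_diff)
    then have "nat \<lfloor>1 * real n * 1.3 ^ n\<rfloor> \<le> 2 * C - 2"
      using bound by linarith
    then show ?thesis by (simp add: C_def h_def)
  qed
  then show ?thesis by blast
qed

theorem theorem4:
  fixes V :: "'v set"
  assumes "finite V" and "card V \<ge> 2"
  shows "\<exists>(\<kappa>::real) n\<^sub>0. \<kappa> > 0 \<and>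
    (\<forall>n\<ge>n\<^sub>0. \<exists>D. oblivious_adversary n D \<and> (\<forall>G\<in>D. rooted G) \<and>
       consensus_solvable n V D \<and>
       (\<forall>\<Delta>. correct_consensus n V D \<Delta> \<longrightarrow>
          (\<exists>\<sigma> x. run n V D \<sigma> x \<and>
             (\<exists>p\<in>procs n. \<not> (\<exists>v. decided_by \<Delta> \<sigma> x p (nat \<lfloor>\<kappa> * real n * 1.3 ^ n\<rfloor>) v)))))"
proof -
  obtain a b where ab: "a \<in> V" "b \<in> V" "a \<noteq> b"
    using assms card_le_Suc0_iff_eq[of V] by (auto simp: not_less_eq_eq numeral_2_eq_2)
  obtain n\<^sub>0 where n\<^sub>0:
    "\<And>n. n \<ge> n\<^sub>0 \<Longrightarrow> nat \<lfloor>1 * real n * 1.3 ^ n\<rfloor> \<le> 2 * ((n div 2) choose (n div 2 div 2)) - 2"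
    using round_bound by blast
  show ?thesis
  \<comment> \<open>The threshold 4 gives \<open>n div 2 \<ge> 2\<close>, so that the sets
    \<open>R t\<close> have positive size.\<close>
  proof (rule exI[of _ 1], rule exI[of _ "max n\<^sub>0 4"], intro conjI allI impI)
    fix n assume n: "n \<ge> max n\<^sub>0 4"
    let ?h = "n div 2"
    obtain R where "star_adversary n (?h div 2) (2 * (?h choose (?h div 2))) R"
      using star_adversary_exists[of n] n by fastforce
    then interpret star_adversary n "?h div 2" "2 * (?h choose (?h div 2))" R .
    show "\<exists>D. oblivious_adversary n D \<and> (\<forall>G\<in>D. rooted G) \<and> consensus_solvable n V D \<and>
       (\<forall>\<Delta>. correct_consensus n V D \<Delta> \<longrightarrow>
          (\<exists>\<sigma> x. run n V D \<sigma> x \<and>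
             (\<exists>p\<in>procs n. \<not> (\<exists>v. decided_by \<Delta> \<sigma> x p (nat \<lfloor>1 * real n * 1.3 ^ n\<rfloor>) v))))"
    proof (intro exI[of _ D] conjI ballI allI impI)
      show "rooted G" if "G \<in> D" for G
        using that rooted_graph by (auto simp: D_def)
      show "\<exists>\<sigma> x. run n V D \<sigma> x \<and>
          (\<exists>p\<in>procs n. \<not> (\<exists>v. decided_by \<Delta> \<sigma> x p (nat \<lfloor>1 * real n * 1.3 ^ n\<rfloor>) v))"
        if "correct_consensus n V D \<Delta>" for \<Delta>
        using undecided[OF that ab] n\<^sub>0 n by simp
    qed (use oblivious solvable in auto)
  qed simp
qed

end
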